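(* Let $0<|q|<1$ and let $F_0,F_1,F_2,G_0,G_1,G_2,F_0^{\star},F_1^{\star},F_2^{\star},G_0^{\star},G_1^{\star},G_2^{\star}$ be the double series defined in the context. Then $$F_0(q)=F_1(q)+q^2F_2(q)+1,$$ $$G_0(q)=G_1(q)+q^2G_2(q),$$ $$F_2^{\star}(q)=F_0^{\star}(q)+F_1^{\star}(q)+1,$$ $$G_2^{\star}(q)=G_0^{\star}(q)+G_1^{\star}(q).$$
   Context: Here $q$ is a nonzero complex number with $|q|<1$, and $(x;q)_n=\prod_{i=0}^{n-1}(1-q^ix)$. For $k,l\in\mathbb{Z}$ the Gaussian binomial coefficient is $\begin{bmatrix}k\\ l\end{bmatrix}_q=\frac{(q;q)_k}{(q;q)_l(q;q)_{k-l}}$ if $k\ge l\ge 0$, and $0$ if $l<0$ or $k<l$ (in particular $\begin{bmatrix}-1\\ 0\end{bmatrix}_q=0$). The series are $$F_0(q)=\sum_{a,b\ge 0}\frac{q^{a^2-3ab+3b^2+a-b}}{(q^3;q^3)_b}\begin{bmatrix}3b-a\\ a\end{bmatrix}_q,\qquad G_0(q)=\sum_{a,b\ge 0}\frac{q^{a^2-3ab+3b^2+2b+1}}{(q^3;q^3)_b}\begin{bmatrix}3b-a+1\\ a\end{bmatrix}_q,$$ $$F_1(q)=\sum_{a,b\ge 0}\frac{q^{a^2-3ab+3b^2+a-b}}{(q^3;q^3)_b}\begin{bmatrix}3b-a-1\\ a\end{bmatrix}_q,\qquad G_1(q)=\sum_{a,b\ge 0}\frac{q^{a^2-3ab+3b^2+2b+1}}{(q^3;q^3)_b}\begin{bmatrix}3b-a\\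 a\end{bmatrix}_q,$$ $$F_2(q)=\sum_{a,b\ge 0}\frac{q^{a^2-3ab+3b^2+a-b-2}}{(q^3;q^3)_b}\begin{bmatrix}3b-a-2\\ a\end{bmatrix}_q,\qquad G_2(q)=\sum_{a,b\ge 0}\frac{q^{a^2-3ab+3b^2+2b-1}}{(q^3;q^3)_b}\begin{bmatrix}3b-a-1\\ a\end{bmatrix}_q,$$ $$F_0^{\star}(q)=\sum_{a,b\ge 0}\frac{q^{a^2-3ab+3b^2+a-2b}}{(q^3;q^3)_b}\begin{bmatrix}3b-a-1\\ a\end{bmatrix}_q,\qquad G_0^{\star}(q)=\sum_{a,b\ge 0}\frac{q^{a^2-3ab+3b^2-2a+4b+1}}{(q^3;q^3)_b}\begin{bmatrix}3b-a+2\\ a\end{bmatrix}_q,$$ $$F_1^{\star}(q)=\sum_{a,b\ge 0}\frac{q^{a^2-3ab+3b^2+a-2b}}{(q^3;q^3)_b}\begin{bmatrix}3b-a-2\\ a\end{bmatrix}_q,\qquad G_1^{\star}(q)=\sum_{a,b\ge 0}\frac{q^{a^2-3ab+3b^2-2a+4b+1}}{(q^3;q^3)_b}\begin{bmatrix}3b-a+1\\ a\end{bmatrix}_q,$$ $$F_2^{\star}(q)=\sum_{a,b\ge 0}\frac{q^{a^2-3ab+3b^2+a-2b}}{(q^3;q^3)_b}\begin{bmatrix}3b-a\\ a\end{bmatrix}_q,\qquad G_2^{\star}(q)=\sum_{a,b\ge 0}\frac{q^{a^2-3ab+3b^2-2a+4b+1}}{(q^3;q^3)_b}\begin{bmatrix}3b-a+3\\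 a\end{bmatrix}_q.$$ *)

theory Defs
  imports "HOL-Analysis.Infinite_Sum"
begin

definition qpoch :: "complex \<Rightarrow> complex \<Rightarrow> nat \<Rightarrow> complex" where
  "qpoch x q n = (\<Prod>i<n. 1 - q ^ i * x)"

definition gauss_binom :: "complex \<Rightarrow> int \<Rightarrow> int \<Rightarrow> complex" where
  "gauss_binom q k l =
     (if 0 \<le> l \<and> l \<le> k
      then qpoch q q (nat k) / (qpoch q q (nat l) * qpoch q q (nat (k - l)))
      else 0)"

text \<open>
  The double series are unordered (absolutely convergent) sums over all pairs of
  natural numbers. Exponents and upper indices of Gaussian binomials are computed in
  the integers, as they may be negative; hence the integer power and the casts.
\<close>

definition F0 :: "complex \<Rightarrow> complex" where
  "F0 q = (\<Sum>\<^sub>\<infinity>(a::nat, b::nat).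
     q powi (int a ^ 2 - 3 * int a * int b + 3 * int b ^ 2 + int a - int b)
       / qpoch (q ^ 3) (q ^ 3) b * gauss_binom q (3 * int b - int a) (int a))"

definition G0 :: "complex \<Rightarrow> complex" where
  "G0 q = (\<Sum>\<^sub>\<infinity>(a::nat, b::nat).
     q powi (int a ^ 2 - 3 * int a * int b + 3 * int b ^ 2 + 2 * int b + 1)
       / qpoch (q ^ 3) (q ^ 3) b * gauss_binom q (3 * int b - int a + 1) (int a))"

definition F1 :: "complex \<Rightarrow> complex" where
  "F1 q = (\<Sum>\<^sub>\<infinity>(a::nat, b::nat).
     q powi (int a ^ 2 - 3 * int a * int b + 3 * int b ^ 2 + int a - int b)
       / qpoch (q ^ 3) (q ^ 3) b * gauss_binom q (3 * int b - int a - 1) (int a))"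

definition G1 :: "complex \<Rightarrow> complex" where
  "G1 q = (\<Sum>\<^sub>\<infinity>(a::nat, b::nat).
     q powi (int a ^ 2 - 3 * int a * int b + 3 * int b ^ 2 + 2 * int b + 1)
       / qpoch (q ^ 3) (q ^ 3) b * gauss_binom q (3 * int b - int a) (int a))"

definition F2 :: "complex \<Rightarrow> complex" where
  "F2 q = (\<Sum>\<^sub>\<infinity>(a::nat, b::nat).
     q powi (int a ^ 2 - 3 * int a * int b + 3 * int b ^ 2 + int a - int b - 2)
       / qpoch (q ^ 3) (q ^ 3) b * gauss_binom q (3 * int b - int a - 2) (int a))"

definition G2 :: "complex \<Rightarrow> complex" where
  "G2 q = (\<Sum>\<^sub>\<infinity>(a::nat, b::nat).
     q powi (int a ^ 2 - 3 * int a * int b + 3 * int b ^ 2 + 2 * int b - 1)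
       / qpoch (q ^ 3) (q ^ 3) b * gauss_binom q (3 * int b - int a - 1) (int a))"

definition F0_star :: "complex \<Rightarrow> complex" where
  "F0_star q = (\<Sum>\<^sub>\<infinity>(a::nat, b::nat).
     q powi (int a ^ 2 - 3 * int a * int b + 3 * int b ^ 2 + int a - 2 * int b)
       / qpoch (q ^ 3) (q ^ 3) b * gauss_binom q (3 * int b - int a - 1) (int a))"

definition G0_star :: "complex \<Rightarrow> complex" where
  "G0_star q = (\<Sum>\<^sub>\<infinity>(a::nat, b::nat).
     q powi (int a ^ 2 - 3 * int a * int b + 3 * int b ^ 2 - 2 * int a + 4 * int b + 1)
       / qpoch (q ^ 3) (q ^ 3) b * gauss_binom q (3 * int b - int a + 2) (int a))"

definition F1_star :: "complex \<Rightarrow> complex" where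
  "F1_star q = (\<Sum>\<^sub>\<infinity>(a::nat, b::nat).
     q powi (int a ^ 2 - 3 * int a * int b + 3 * int b ^ 2 + int a - 2 * int b)
       / qpoch (q ^ 3) (q ^ 3) b * gauss_binom q (3 * int b - int a - 2) (int a))"

definition G1_star :: "complex \<Rightarrow> complex" where
  "G1_star q = (\<Sum>\<^sub>\<infinity>(a::nat, b::nat).
     q powi (int a ^ 2 - 3 * int a * int b + 3 * int b ^ 2 - 2 * int a + 4 * int b + 1)
       / qpoch (q ^ 3) (q ^ 3) b * gauss_binom q (3 * int b - int a + 1) (int a))"

definition F2_star :: "complex \<Rightarrow> complex" where
  "F2_star q = (\<Sum>\<^sub>\<infinity>(a::nat, b::nat).
     q powi (int a ^ 2 - 3 * int a * int b + 3 * int b ^ 2 + int a - 2 * int b)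
       / qpoch (q ^ 3) (q ^ 3) b * gauss_binom q (3 * int b - int a) (int a))"

definition G2_star :: "complex \<Rightarrow> complex" where
  "G2_star q = (\<Sum>\<^sub>\<infinity>(a::nat, b::nat).
     q powi (int a ^ 2 - 3 * int a * int b + 3 * int b ^ 2 - 2 * int a + 4 * int b + 1)
       / qpoch (q ^ 3) (q ^ 3) b * gauss_binom q (3 * int b - int a + 3) (int a))"

end

theory Submission
  imports Defs "HOL-Analysis.Infinite_Products"
begin

text \<open>
  All four identities are the \<open>q\<close>-Pascal rule
  \<open>[k+1, a+1] = [k, a+1] + q^(k-a) [k, a]\<close> applied to each term. Consider the series with
  terms \<open>q^(a^2 - 3ab + 3b^2 + la + mb + c) / (q^3; q^3)_b [3b-a+s+1, a]\<close>. The first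
  summand of the Pascal rule gives the series with \<open>s\<close> in place of \<open>s + 1\<close>. In the second,
  substituting \<open>a + 1\<close> for \<open>a\<close> lowers the upper index to \<open>3b-a+s-1\<close> and adds \<open>l + s\<close> to the
  exponent, so that the exponent is preserved exactly when \<open>l = -s\<close>, which holds in every case
  here. The rule fails only for \<open>[0, 0] = 1\<close>; this accounts for the additional \<open>1\<close>, coming from
  \<open>a = b = 0\<close> when \<open>s = -1\<close> (lemma \<open>double_series_rec\<close>).

  Splitting the sums requires absolute convergence (lemma \<open>double_term_summable\<close>). The Gaussian
  binomials and the factors \<open>1 / (q^3; q^3)_b\<close> are bounded, because \<open>(x; x)_n\<close> converges to a
  nonzero limit for \<open>|x| < 1\<close>, and the quadratic form is positive definite, so that the exponent
  is at least \<open>a + b - D\<close> for a constant \<open>D\<close>.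
\<close>

section \<open>Gaussian binomial coefficients\<close>

lemma qpoch_self_Suc: "qpoch q q (Suc n) = qpoch q q n * (1 - q ^ Suc n)"
  by (simp add: qpoch_def mult.commute)

lemma one_minus_power_nonzero:
  fixes q :: complex
  assumes "norm q < 1"
  shows "1 - q ^ Suc n \<noteq> 0"
proof
  assume "1 - q ^ Suc n = 0"
  hence "norm q ^ Suc n = 1"
    by (metis eq_iff_diff_eq_0 norm_one norm_power)
  moreover have "norm q ^ Suc n < 1"
    using assms by (simp add: power_less_one_iff del: power_Suc)
  ultimately show False by simp
qed

lemma qpoch_self_nonzero:
  assumes "norm q < 1"
  shows "qpoch q q n \<noteq> 0"
  using one_minus_power_nonzero[OF assms]
  by (induction n) (auto simp: qpoch_self_Suc, simp add: qpoch_def)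

lemma gauss_binom_0_right:
  assumes "norm q < 1"
  shows "gauss_binom q k 0 = (if 0 \<le> k then 1 else 0)"
  using qpoch_self_nonzero[OF assms] by (auto simp: gauss_binom_def qpoch_def)

lemma gauss_binom_pascal:
  assumes "norm q < 1"
  shows "gauss_binom q (k + 1) (int (Suc a)) =
         gauss_binom q k (int (Suc a)) + q powi (k - int a) * gauss_binom q k (int a)"
proof -
  have nz: "qpoch q q n \<noteq> 0" for n
    by (rule qpoch_self_nonzero[OF assms])
  consider "k < int a" | "k = int a" | "k > int a" by linarith
  thus ?thesis
  proof cases
    case 1
    thus ?thesis by (simp add: gauss_binom_def)
  next
    case 2
    have "nat (1 + int a) = Suc a" by simp
    moreover have "qpoch q q 0 = 1" by (simp add: qpoch_def)
    ultimately show ?thesis using 2 nz by (simp add: gauss_binom_def add.commute)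
  next
    case 3
    define d where "d = nat (k - int a - 1)"
    have k: "k = int (a + Suc d)"
      using 3 by (simp add: d_def)
    have idx: "nat (k + 1) = Suc (a + Suc d)" "nat k = a + Suc d"
      "k + 1 - int (Suc a) = int (Suc d)" "k - int (Suc a) = int d" "k - int a = int (Suc d)"
      by (simp_all add: k)
    have le: "int (Suc a) \<le> k + 1" "int (Suc a) \<le> k" "int a \<le> k"
      by (simp_all add: k)
    define P where "P = qpoch q q (a + Suc d)"
    define A where "A = qpoch q q a"
    define B where "B = qpoch q q d"
    have pw: "q ^ Suc (a + Suc d) = q ^ Suc a * q ^ Suc d"
      by (simp flip: power_add power_Suc)
    have *: "P * (1 - x * y) / ((A * (1 - x)) * (B * (1 - y))) =
        P / ((A * (1 - x)) * B) + y * (P / (A * (B * (1 - y))))"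
      if "1 - x \<noteq> 0" "1 - y \<noteq> 0" for x y
    proof -
      have **: "P * (v + y * u) / ((A * u) * (B * v)) = P / ((A * u) * B) + y * (P / (A * (B * v)))"
        if "u \<noteq> 0" "v \<noteq> 0" for u v
        using that nz[of a] nz[of d] by (simp add: A_def B_def field_simps)
      have "1 - x * y = (1 - y) + y * (1 - x)" by (simp add: algebra_simps)
      thus ?thesis using **[OF that(1,2)] by (simp only:)
    qed
    have "gauss_binom q (k + 1) (int (Suc a)) =
          P * (1 - q ^ Suc a * q ^ Suc d) / ((A * (1 - q ^ Suc a)) * (B * (1 - q ^ Suc d)))"
      using le unfolding gauss_binom_def idx nat_int qpoch_self_Suc pw P_def A_def B_def by simp
    also have "\<dots> = P / ((A * (1 - q ^ Suc a)) * B) + q ^ Suc d * (P / (A * (B * (1 - q ^ Suc d))))"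
      by (rule *; rule one_minus_power_nonzero[OF assms])
    also have "P / ((A * (1 - q ^ Suc a)) * B) = gauss_binom q k (int (Suc a))"
      using le unfolding gauss_binom_def idx nat_int P_def A_def B_def
      by (simp add: qpoch_self_Suc)
    also have "P / (A * (B * (1 - q ^ Suc d))) = gauss_binom q k (int a)"
      using le unfolding gauss_binom_def idx nat_int P_def A_def B_def
      by (simp add: qpoch_self_Suc)
    also have "q ^ Suc d = q powi (k - int a)"
      unfolding idx by (rule power_int_of_nat[symmetric])
    finally show ?thesis .
  qed
qed

section \<open>Absolute convergence\<close>

lemma qpoch_self_bounds:
  assumes "norm q < 1"
  obtains C where "C > 0" "\<And>n. norm (qpoch q q n) \<le> C" "\<And>n. norm (inverse (qpoch q q n)) \<le> C"
proof -
  define f where "f i = 1 - q ^ Suc i" for i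
  have f0: "f i \<noteq> 0" for i
    unfolding f_def by (rule one_minus_power_nonzero[OF assms])
  have "summable (\<lambda>i. norm q * norm q ^ i)"
    using assms by (intro summable_mult summable_geometric) auto
  hence "summable (\<lambda>i. norm (f i - 1))"
    by (simp add: f_def norm_mult norm_power)
  hence "convergent_prod f"
    by (intro abs_convergent_prod_imp_convergent_prod summable_imp_abs_convergent_prod)
  then obtain L where L: "(\<lambda>n. \<Prod>i\<le>n. f i) \<longlonglongrightarrow> L" "L \<noteq> 0"
    using convergent_prod_iff_nz_lim[of f] f0 by auto
  have "(\<lambda>n. \<Prod>i<n. f i) \<longlonglongrightarrow> L"
    using L(1) by (simp add: LIMSEQ_lessThan_iff_atMost)
  moreover have "(\<Prod>i<n. f i) = qpoch q q n" for n
    by (simp add: f_def qpoch_def mult.commute)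
  ultimately have lim: "(\<lambda>n. qpoch q q n) \<longlonglongrightarrow> L" by simp
  have "Bseq (\<lambda>n. qpoch q q n)" "Bseq (\<lambda>n. inverse (qpoch q q n))"
    using lim tendsto_inverse[OF lim L(2)]
    by (auto intro!: convergent_imp_Bseq simp: convergent_def)
  then obtain C1 C2 where "\<And>n. norm (qpoch q q n) \<le> C1" "C1 > 0"
      "\<And>n. norm (inverse (qpoch q q n)) \<le> C2"
    by (auto simp: Bseq_def)
  thus ?thesis
    by (intro that[of "max C1 C2"]) (auto intro: max.coboundedI1 max.coboundedI2)
qed

lemma gauss_binom_bounded:
  assumes "norm q < 1"
  obtains C where "C \<ge> 0" "\<And>k l. norm (gauss_binom q k l) \<le> C"
proof -
  obtain C where C: "C > 0" "\<And>n. norm (qpoch q q n) \<le> C"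
      "\<And>n. norm (inverse (qpoch q q n)) \<le> C"
    using qpoch_self_bounds[OF assms] by blast
  have "norm (gauss_binom q k l) \<le> C * (C * C)" for k l
  proof (cases "0 \<le> l \<and> l \<le> k")
    case True
    have "norm (gauss_binom q k l) = norm (qpoch q q (nat k)) *
        (norm (inverse (qpoch q q (nat l))) * norm (inverse (qpoch q q (nat (k - l)))))"
      using True by (simp add: gauss_binom_def divide_inverse norm_mult norm_inverse)
    also have "\<dots> \<le> C * (C * C)"
      using C by (intro mult_mono) auto
    finally show ?thesis .
  next
    case False
    thus ?thesis using C(1) by (auto simp: gauss_binom_def)
  qed
  thus ?thesis using C(1) by (intro that[of "C * (C * C)"]) auto
qed

text \<open>
  The quadratic form dominates any linear form; the sum of squares below comes from
  \<open>8 (a^2 - 3ab + 3b^2) = a^2 + b^2 + (7a^2 - 24ab + 23b^2)\<close>, where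
  \<open>7 (7a^2 - 24ab + 23b^2) = (7a - 12b)^2 + 17b^2\<close>.
\<close>
lemma exponent_lower_bound:
  fixes a b l m c :: int
  shows "a + b - (2 * (l - 1)\<^sup>2 + 2 * (m - 1)\<^sup>2 - c) \<le> a\<^sup>2 - 3 * a * b + 3 * b\<^sup>2 + l * a + m * b + c"
proof -
  have "0 \<le> (7 * a - 12 * b)\<^sup>2 + 17 * b\<^sup>2 + 7 * (a + 4 * (l - 1))\<^sup>2 + 7 * (b + 4 * (m - 1))\<^sup>2"
    by simp
  thus ?thesis by (simp add: power2_eq_square algebra_simps)
qed

text \<open>
  The common shape of the terms of all the double series: \<open>l\<close>, \<open>m\<close>, \<open>c\<close> are the coefficients of
  the linear part of the exponent, and \<open>s\<close> is the shift of the upper index of the Gaussian binomial.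
\<close>
definition double_term :: "complex \<Rightarrow> int \<Rightarrow> int \<Rightarrow> int \<Rightarrow> int \<Rightarrow> nat \<times> nat \<Rightarrow> complex" where
  "double_term q l m c s = (\<lambda>(a, b).
     q powi (int a ^ 2 - 3 * int a * int b + 3 * int b ^ 2 + l * int a + m * int b + c)
       / qpoch (q ^ 3) (q ^ 3) b * gauss_binom q (3 * int b - int a + s) (int a))"

lemma summable_on_geometric_product:
  fixes r :: real
  assumes "0 \<le> r" "r < 1"
  shows "(\<lambda>(a, b). r ^ a * r ^ b) summable_on (UNIV :: (nat \<times> nat) set)"
proof -
  have geo: "((\<lambda>b. r ^ b) has_sum (1 / (1 - r))) UNIV"
    using assms by (intro norm_summable_imp_has_sum geometric_sums) auto
  have "(\<lambda>(a, b). r ^ a * r ^ b) summable_on (UNIV :: nat set) \<times> (UNIV :: nat set)"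
  proof (rule summable_on_SigmaI)
    show "((\<lambda>b. case (a, b) of (a, b) \<Rightarrow> r ^ a * r ^ b) has_sum (r ^ a * (1 / (1 - r)))) UNIV" for a
      using has_sum_cmult_right[OF geo, of "r ^ a"] by simp
    show "(\<lambda>a. r ^ a * (1 / (1 - r))) summable_on UNIV"
      using has_sum_imp_summable[OF geo] by (rule summable_on_cmult_left)
  qed (use assms in auto)
  thus ?thesis by simp
qed

lemma double_term_summable:
  assumes "0 < norm q" "norm q < 1"
  shows "double_term q l m c s summable_on UNIV"
proof -
  define r where "r = norm q"
  have r: "0 < r" "r < 1" using assms by (auto simp: r_def)
  define D where "D = 2 * (l - 1)\<^sup>2 + 2 * (m - 1)\<^sup>2 - c"
  have "norm (q ^ 3) < 1"
    using assms by (simp add: norm_power power_less_one_iff)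
  then obtain C1 where C1: "C1 > 0" "\<And>n. norm (inverse (qpoch (q ^ 3) (q ^ 3) n)) \<le> C1"
    using qpoch_self_bounds by metis
  obtain C2 where C2: "C2 \<ge> 0" "\<And>k l. norm (gauss_binom q k l) \<le> C2"
    using gauss_binom_bounded[OF assms(2)] by blast
  have bound: "norm (double_term q l m c s (a, b)) \<le> (r powi (- D) * (C1 * C2)) * (r ^ a * r ^ b)"
    for a b
  proof -
    let ?e = "int a ^ 2 - 3 * int a * int b + 3 * int b ^ 2 + l * int a + m * int b + c"
    have "r powi ?e \<le> r powi (int a + int b - D)"
      using exponent_lower_bound[of "int a" "int b" l m c] r unfolding D_def
      by (intro power_int_decreasing) auto
    also have "\<dots> = r powi (- D) * (r ^ a * r ^ b)"
      using r by (simp add: power_int_add power_int_diff power_int_minus divide_inverse)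
    finally have e: "r powi ?e \<le> r powi (- D) * (r ^ a * r ^ b)" .
    have "norm (double_term q l m c s (a, b)) = r powi ?e *
        (norm (inverse (qpoch (q ^ 3) (q ^ 3) b)) *
         norm (gauss_binom q (3 * int b - int a + s) (int a)))"
      by (simp add: double_term_def r_def norm_mult norm_divide norm_power_int norm_inverse
          divide_inverse)
    also have "\<dots> \<le> (r powi (- D) * (r ^ a * r ^ b)) * (C1 * C2)"
      using e C1 C2 r by (intro mult_mono) auto
    finally show ?thesis by (simp only: mult_ac)
  qed
  have "(\<lambda>p. (r powi (- D) * (C1 * C2)) * (case p of (a, b) \<Rightarrow> r ^ a * r ^ b)) summable_on UNIV"
    using r by (intro summable_on_cmult_right summable_on_geometric_product) auto
  hence "(\<lambda>p. norm (double_term q l m c s p)) summable_on UNIV"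
    by (rule abs_summable_on_comparison_test') (use bound in auto)
  thus ?thesis by (rule abs_summable_summable)
qed

section \<open>The recurrence for the double series\<close>

text \<open>
  The second summand of the Pascal rule, for \<open>a + 1\<close> in place of \<open>a\<close>: the exponent is unchanged
  because the coefficient of \<open>a\<close> is \<open>-s\<close>.
\<close>
lemma double_term_Suc:
  assumes "0 < norm q" "norm q < 1"
  shows "double_term q (- s) m c (s + 1) (Suc a, b) =
         double_term q (- s) m c s (Suc a, b) + double_term q (- s) m c (s - 1) (a, b)"
proof -
  define k where "k = 3 * int b - int a + s - 1"
  let ?E = "\<lambda>a. int a ^ 2 - 3 * int a * int b + 3 * int b ^ 2 + - s * int a + m * int b + c"
  have q: "q \<noteq> 0" using assms by auto
  have "?E (Suc a) + (k - int a) = ?E a"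
    by (simp add: k_def power2_eq_square algebra_simps)
  hence pw: "q powi ?E (Suc a) * q powi (k - int a) = q powi ?E a"
    using q by (metis power_int_add)
  have idx: "3 * int b - int (Suc a) + (s + 1) = k + 1" "3 * int b - int (Suc a) + s = k"
      "3 * int b - int a + (s - 1) = k"
    by (simp_all add: k_def)
  show ?thesis
    unfolding double_term_def prod.case idx gauss_binom_pascal[OF assms(2)] pw[symmetric]
    by (simp add: distrib_left)
qed

lemma double_series_rec:
  assumes q: "0 < norm q" "norm q < 1" and s: "s \<ge> -1"
  shows "infsum (double_term q (- s) m c (s + 1)) UNIV =
         infsum (double_term q (- s) m c s) UNIV + infsum (double_term q (- s) m c (s - 1)) UNIV
         + (if s = -1 then q powi c else 0)"
proof -
  define T where "T = double_term q (- s) m c"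
  define sh :: "nat \<times> nat \<Rightarrow> nat \<times> nat" where "sh = (\<lambda>(a, b). (Suc a, b))"
  define h where "h = (\<lambda>(a, b). if a = 0 then 0 else T (s - 1) (a - 1, b))"
  define d where "d = (\<lambda>p :: nat \<times> nat. if p = (0, 0) \<and> s = -1 then q powi c else 0)"
  have inj: "inj sh" by (auto simp: sh_def inj_def)
  have "(T (s - 1) has_sum infsum (T (s - 1)) UNIV) UNIV"
    unfolding T_def by (intro has_sum_infsum double_term_summable q)
  moreover have "h \<circ> sh = T (s - 1)" by (auto simp: h_def sh_def)
  ultimately have "(h has_sum infsum (T (s - 1)) UNIV) (range sh)"
    using inj by (simp add: has_sum_reindex)
  also have "?this \<longleftrightarrow> (h has_sum infsum (T (s - 1)) UNIV) UNIV"
  proof (rule has_sum_cong_neutral)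
    fix p assume "p \<in> UNIV - range sh"
    thus "h p = 0"
      by (cases p; cases "fst p") (auto simp: h_def sh_def image_iff)
  qed auto
  finally have h: "(h has_sum infsum (T (s - 1)) UNIV) UNIV" .
  have "(d has_sum (\<Sum>p\<in>{(0, 0)}. d p)) {(0, 0)}"
    by (rule has_sum_finite) simp
  also have "?this \<longleftrightarrow> (d has_sum (\<Sum>p\<in>{(0, 0)}. d p)) UNIV"
    by (rule has_sum_cong_neutral) (auto simp: d_def)
  finally have d: "(d has_sum (if s = -1 then q powi c else 0)) UNIV"
    by (simp add: d_def)
  have "(T s has_sum infsum (T s) UNIV) UNIV"
    unfolding T_def by (intro has_sum_infsum double_term_summable q)
  hence sum: "((\<lambda>p. T s p + h p + d p) has_sum (infsum (T s) UNIV + infsum (T (s - 1)) UNIV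
      + (if s = -1 then q powi c else 0))) UNIV"
    by (intro has_sum_add h d)
  have "T s p + h p + d p = T (s + 1) p" for p
  proof -
    obtain a b where p: "p = (a, b)" by (cases p)
    show ?thesis
    proof (cases a)
      case 0
      \<comment> \<open>Here \<open>[3b+s+1, 0] = 1\<close>, while \<open>[3b+s, 0] = 0\<close> exactly for \<open>b = 0\<close>, \<open>s = -1\<close>.\<close>
      show ?thesis
        using s by (auto simp: p 0 T_def double_term_def h_def d_def gauss_binom_0_right[OF q(2)]
            qpoch_def)
    next
      case (Suc a')
      thus ?thesis
        using double_term_Suc[OF q, of s m c a' b] by (simp add: p T_def h_def d_def)
    qed
  qed
  with sum have "infsum (T (s + 1)) UNIV = infsum (T s) UNIV + infsum (T (s - 1)) UNIV
      + (if s = -1 then q powi c else 0)"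
    by (simp add: infsumI)
  thus ?thesis by (simp only: T_def)
qed

lemma double_series_shift_exponent:
  assumes "q \<noteq> 0"
  shows "q ^ 2 * infsum (double_term q l m (c - 2) s) UNIV = infsum (double_term q l m c s) UNIV"
proof -
  have "q ^ 2 * double_term q l m (c - 2) s p = double_term q l m c s p" for p
  proof (cases p)
    case (Pair a b)
    let ?e = "int a ^ 2 - 3 * int a * int b + 3 * int b ^ 2 + l * int a + m * int b"
    have "q ^ 2 * q powi (?e + (c - 2)) = q powi (?e + c)"
      using assms power_int_add[of q 2 "?e + (c - 2)"] by (simp add: algebra_simps)
    thus ?thesis by (simp add: Pair double_term_def flip: mult.assoc)
  qed
  thus ?thesis by (simp flip: infsum_cmult_right')
qed

theorem theorem7p1:
  fixes q :: complex
  assumes "0 < norm q" and "norm q < 1"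
  shows "F0 q = F1 q + q ^ 2 * F2 q + 1 \<and>
         G0 q = G1 q + q ^ 2 * G2 q \<and>
         F2_star q = F0_star q + F1_star q + 1 \<and>
         G2_star q = G0_star q + G1_star q"
proof -
  define S where "S l m c s = infsum (double_term q l m c s) UNIV" for l m c s
  note rec = double_series_rec[OF assms, folded S_def]
  have "q \<noteq> 0" using assms by auto
  note shift = double_series_shift_exponent[OF this, folded S_def]
  have F: "F0 q = S 1 (-1) 0 0" "F1 q = S 1 (-1) 0 (-1)" "F2 q = S 1 (-1) (-2) (-2)"
    by (simp_all add: F0_def F1_def F2_def S_def double_term_def)
  have G: "G0 q = S 0 2 1 1" "G1 q = S 0 2 1 0" "G2 q = S 0 2 (-1) (-1)"
    by (simp_all add: G0_def G1_def G2_def S_def double_term_def)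
  have F_star: "F2_star q = S 1 (-2) 0 0" "F0_star q = S 1 (-2) 0 (-1)"
      "F1_star q = S 1 (-2) 0 (-2)"
    by (simp_all add: F0_star_def F1_star_def F2_star_def S_def double_term_def)
  have G_star: "G2_star q = S (-2) 4 1 3" "G0_star q = S (-2) 4 1 2" "G1_star q = S (-2) 4 1 1"
    by (simp_all add: G0_star_def G1_star_def G2_star_def S_def double_term_def)
  show ?thesis
    unfolding F G F_star G_star
    using rec[of "-1" "-1" 0] rec[of 0 2 1] rec[of "-1" "-2" 0] rec[of 2 4 1]
      shift[of 1 "-1" 0 "-2"] shift[of 0 2 1 "-1"]
    by simp
qed

end
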